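(* Let $\alpha>0$ and $\epsilon>0$. In the no-information two-database setting, no $\epsilon$-pDP property tester with proximity parameter $\alpha$ has finite query complexity.
   Context: An algorithm in the two-database setting is a pair $\mathcal{A}=(P_0,P_1)$ of probability distributions on $[n]=\{1,\dots,n\}$: it accepts two (neighbouring) databases $0,1$ as input, and querying database $i$ returns an independent sample from $P_i$. With $D_\infty(P,Q)=\sup_E\ln\frac{P(E)}{Q(E)}$ (supremum over events), $\mathcal{A}$ is $\epsilon$-pDP (pure differentially private) if $D_\infty(P_0,P_1)\le\epsilon$ and $D_\infty(P_1,P_0)\le\epsilon$. $\mathcal{A}$ is $\alpha$-far from $\epsilon$-pDP if $|\epsilon'-\epsilon|>\alpha$ for every $\epsilon'$ such that $\mathcal{A}$ is $\epsilon'$-pDP (in particular if there is no such $\epsilon'$). A (no-information) $\epsilon$-pDP property tester with proximity parameter $\alpha$ and query complexity $r$ per database receives $r$ independent samples from each of the unknown $P_0,P_1$ (and no other information about the algorithm except its domain $\{0,1\}$ and range $[n]$), and ACCEPTS with probability at least $2/3$ if $\mathcal{A}$ is $\epsilon$-pDP and REJECTS with probability at least $2/3$ if $\mathcal{A}$ is $\alpha$-far from $\epsilon$-pDP. *)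

theory Defs
  imports "HOL-Probability.Probability"
begin

type_synonym two_db_alg = "nat pmf \<times> nat pmf"

definition alg_on :: "nat \<Rightarrow> two_db_alg \<Rightarrow> bool" where
  "alg_on n A \<longleftrightarrow> set_pmf (fst A) \<subseteq> {1..n} \<and> set_pmf (snd A) \<subseteq> {1..n}"

text \<open>
  The value \<open>ln (P E / Q E)\<close> in the extended reals, with \<open>p / 0 = \<infinity>\<close> for \<open>p > 0\<close> and
  \<open>ln 0 = -\<infinity>\<close>.  The undefined form \<open>0 / 0\<close> is kept out of the supremum by \<open>D_inf\<close>.
\<close>

definition log_ratio :: "real \<Rightarrow> real \<Rightarrow> ereal" where
  "log_ratio p q = (if q = 0 then \<infinity> else if p = 0 then -\<infinity> else ereal (ln (p / q)))"

definition D_inf :: "'a pmf \<Rightarrow> 'a pmf \<Rightarrow> ereal" where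
  "D_inf P Q =
    (SUP E \<in> {E. measure_pmf.prob P E \<noteq> 0 \<or> measure_pmf.prob Q E \<noteq> 0}.
       log_ratio (measure_pmf.prob P E) (measure_pmf.prob Q E))"

definition pDP :: "real \<Rightarrow> two_db_alg \<Rightarrow> bool" where
  "pDP \<epsilon> A \<longleftrightarrow> D_inf (fst A) (snd A) \<le> ereal \<epsilon> \<and> D_inf (snd A) (fst A) \<le> ereal \<epsilon>"

definition far_from_pDP :: "real \<Rightarrow> real \<Rightarrow> two_db_alg \<Rightarrow> bool" where
  "far_from_pDP \<alpha> \<epsilon> A \<longleftrightarrow> (\<forall>\<epsilon>'. pDP \<epsilon>' A \<longrightarrow> \<bar>\<epsilon>' - \<epsilon>\<bar> > \<alpha>)"

datatype verdict = Accept | Reject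

text \<open>
  A randomised tester maps the two sample lists (from \<open>P\<^sub>0\<close> and from \<open>P\<^sub>1\<close>) to a distribution
  on verdicts.  Since there are only two verdicts, \<open>verdict pmf\<close> captures every source of
  internal randomness, discrete or not.
\<close>

type_synonym tester = "nat list \<Rightarrow> nat list \<Rightarrow> verdict pmf"

definition run_tester :: "nat \<Rightarrow> tester \<Rightarrow> two_db_alg \<Rightarrow> verdict pmf" where
  "run_tester r T A =
    bind_pmf (pair_pmf (replicate_pmf r (fst A)) (replicate_pmf r (snd A))) (\<lambda>(xs, ys). T xs ys)"

text \<open>
  \<open>T\<close> may depend on \<open>n\<close>, \<open>\<epsilon>\<close>, \<open>\<alpha>\<close> and \<open>r\<close>, but not on the algorithm \<open>A\<close> under test.
\<close>

definition pDP_tester :: "nat \<Rightarrow> real \<Rightarrow> real \<Rightarrow> nat \<Rightarrow> tester \<Rightarrow> bool" where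
  "pDP_tester n \<epsilon> \<alpha> r T \<longleftrightarrow>
    (\<forall>A. alg_on n A \<longrightarrow>
       (pDP \<epsilon> A \<longrightarrow> pmf (run_tester r T A) Accept \<ge> 2 / 3) \<and>
       (far_from_pDP \<alpha> \<epsilon> A \<longrightarrow> pmf (run_tester r T A) Reject \<ge> 2 / 3))"

end

theory Submission
  imports Defs
begin

text \<open>
  Privacy can be destroyed by an event too rare to be observed. If \<open>P\<^sub>0 = P\<^sub>1\<close> is a point mass at \<open>1\<close>,
  the tester sees only ones and must accept. Moving mass \<open>\<delta> > 0\<close> of \<open>P\<^sub>1\<close> to the point \<open>2\<close> makes the
  max-divergence infinite, so the tester must reject; but with probability \<open>(1 - \<delta>)\<^sup>r\<close>, which is close
  to \<open>1\<close> for small \<open>\<delta>\<close>, it still sees only ones.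
\<close>

text \<open>Reaching \<open>y\<close> through \<open>x\<close> is only one of the possible ways: the
  right side is the expectation of \<open>pmf (f z) y\<close> over \<open>z\<close>, and restricting
  this nonnegative integrand to \<open>z = x\<close> gives the left side.\<close>

lemma pmf_bind_ge: "pmf M x * pmf (f x) y \<le> pmf (bind_pmf M f) y"
proof -
  have "pmf M x * pmf (f x) y = measure_pmf.expectation M (\<lambda>z. indicator {x} z * pmf (f x) y)"
    by (simp add: measure_pmf_single)
  also have "\<dots> \<le> measure_pmf.expectation M (\<lambda>z. pmf (f z) y)"
    by (intro integral_mono measure_pmf.integrable_const_bound[where B = 1])
      (auto simp: pmf_le_1 split: split_indicator)
  finally show ?thesis
    by (simp add: pmf_bind)
qed

text \<open>Each draw contributes a factor \<open>pmf p x\<close>: \<open>pmf_bind_ge\<close> fixes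
  the first draw, and prepending \<open>x\<close> is injective, so it preserves the probability of
  the tail.\<close>

lemma pmf_replicate_pmf_replicate_ge: "pmf (replicate_pmf r p) (replicate r x) \<ge> pmf p x ^ r"
proof (induction r)
  case (Suc r)
  have "pmf p x ^ Suc r \<le> pmf p x * pmf (replicate_pmf r p) (replicate r x)"
    using Suc by (simp add: mult_left_mono)
  also have "\<dots> = pmf p x * pmf (map_pmf ((#) x) (replicate_pmf r p)) (x # replicate r x)"
    by (subst pmf_map_inj') auto
  also have "\<dots> \<le> pmf (replicate_pmf (Suc r) p) (replicate (Suc r) x)"
    using pmf_bind_ge[of p x "\<lambda>y. map_pmf ((#) y) (replicate_pmf r p)"]
    by (simp add: map_pmf_def)
  finally show ?case .
qed simp

lemma log_ratio_refl: "p \<noteq> 0 \<Longrightarrow> log_ratio p p = 0"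
  by (simp add: log_ratio_def)

lemma D_inf_refl: "D_inf P P \<le> 0"
  unfolding D_inf_def by (intro SUP_least) (auto simp: log_ratio_refl)

lemma D_inf_eq_infinity:
  assumes "pmf P x \<noteq> 0" "pmf Q x = 0"
  shows "D_inf P Q = \<infinity>"
proof -
  \<comment> \<open>The singleton event already attains infinity, by the convention
    \<open>p / 0 = \<infinity>\<close>.\<close>
  have "log_ratio (measure_pmf.prob P {x}) (measure_pmf.prob Q {x}) \<le> D_inf P Q"
    unfolding D_inf_def using assms by (intro SUP_upper) (auto simp: measure_pmf_single)
  then show ?thesis
    using assms by (simp add: log_ratio_def measure_pmf_single)
qed

lemma pmf_Accept_plus_Reject: "pmf V Accept + pmf V Reject = 1"
proof -
  have "set_pmf V \<subseteq> {Accept, Reject}"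
    using verdict.exhaust by blast
  then show ?thesis
    using sum_pmf_eq_1[of "{Accept, Reject}" V] by simp
qed

theorem theorem10:
  fixes n :: nat and \<epsilon> \<alpha> :: real
  assumes "n \<ge> 2" and "\<alpha> > 0" and "\<epsilon> > 0"
  shows "\<not> (\<exists>r T. pDP_tester n \<epsilon> \<alpha> r T)"
proof
  assume "\<exists>r T. pDP_tester n \<epsilon> \<alpha> r T"
  then obtain r T where T: "pDP_tester n \<epsilon> \<alpha> r T"
    by blast
  define ones where "ones = replicate r (1 :: nat)"
  \<comment> \<open>Chosen so that \<open>r * \<delta> < 1 / 2\<close> strictly, with a nonzero
    denominator also for \<open>r = 0\<close>.\<close>
  define \<delta> :: real where "\<delta> = 1 / (2 * real r + 2)"
  define P :: "nat pmf" where "P = return_pmf 1"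
  define Q :: "nat pmf" where "Q = map_pmf (\<lambda>b. if b then 2 else 1) (bernoulli_pmf \<delta>)"
  have \<delta>: "0 < \<delta>" "\<delta> \<le> 1" "real r * \<delta> < 1 / 2"
    by (auto simp: \<delta>_def field_simps)
  have Q1: "pmf Q 1 = 1 - \<delta>" and Q2: "pmf Q 2 = \<delta>"
    using \<delta> pmf_map_inj'[of "\<lambda>b. if b then 2 else 1 :: nat" "bernoulli_pmf \<delta>" False]
      pmf_map_inj'[of "\<lambda>b. if b then 2 else 1 :: nat" "bernoulli_pmf \<delta>" True]
    by (auto simp: Q_def inj_def)
  have on: "alg_on n (P, P)" "alg_on n (P, Q)"
    using assms(1) by (auto simp: alg_on_def P_def Q_def)

  have "pDP \<epsilon> (P, P)"
    using assms(3) order_trans[OF D_inf_refl[of P], of "ereal \<epsilon>"] by (simp add: pDP_def)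
  then have "pmf (run_tester r T (P, P)) Accept \<ge> 2 / 3"
    using T on(1) by (simp add: pDP_tester_def)
  moreover have "replicate_pmf r P = return_pmf ones"
    unfolding ones_def P_def by (induction r) (simp_all add: bind_return_pmf)
  ultimately have acc: "pmf (T ones ones) Accept \<ge> 2 / 3"
    by (simp add: run_tester_def bind_return_pmf)

  have "D_inf Q P = \<infinity>"
    using \<delta> Q2 by (intro D_inf_eq_infinity[of _ 2]) (auto simp: P_def)
  \<comment> \<open>No real \<epsilon>' bounds an infinite divergence, so farness holds
    vacuously.\<close>
  then have "far_from_pDP \<alpha> \<epsilon> (P, Q)"
    by (simp add: far_from_pDP_def pDP_def)
  then have "pmf (run_tester r T (P, Q)) Reject \<ge> 2 / 3"
    using T on(2) by (simp add: pDP_tester_def)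
  then have rej: "pmf (run_tester r T (P, Q)) Accept \<le> 1 / 3"
    using pmf_Accept_plus_Reject[of "run_tester r T (P, Q)"] by linarith

  \<comment> \<open>By Bernoulli's inequality, all \<open>r\<close> samples from \<open>Q\<close>
    are ones with probability above 1/2.\<close>
  have "1 / 2 < 1 - real r * \<delta>"
    using \<delta> by simp
  also have "\<dots> \<le> (1 - \<delta>) ^ r"
    using Bernoulli_inequality[of "- \<delta>" r] \<delta> by simp
  also have "\<dots> \<le> pmf (replicate_pmf r Q) ones"
    using pmf_replicate_pmf_replicate_ge[of Q 1 r] by (simp only: Q1 ones_def)
  also have "\<dots> = pmf (pair_pmf (replicate_pmf r P) (replicate_pmf r Q)) (ones, ones)"
    using \<open>replicate_pmf r P = return_pmf ones\<close> by (simp add: pmf_pair)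
  \<comment> \<open>The product is exactly the 1/3 that bounds acceptance in \<open>rej\<close>; the
    contradiction rests on the strictness gained from \<delta>.\<close>
  finally have "1 / 2 * (2 / 3) <
      pmf (pair_pmf (replicate_pmf r P) (replicate_pmf r Q)) (ones, ones) * pmf (T ones ones) Accept"
    using acc by (intro mult_less_le_imp_less) auto
  also have "\<dots> \<le> pmf (run_tester r T (P, Q)) Accept"
    using pmf_bind_ge[of _ "(ones, ones)" "\<lambda>(xs, ys). T xs ys" Accept]
    by (simp add: run_tester_def)
  finally show False
    using rej by simp
qed

end
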